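(* Let $s,t$ be real numbers with $s\neq0$, $t\neq0$, and let $q=\varphi'_{s,t}/\varphi_{s,t}$. Then \[ \sum_{n=1}^{\infty}\genfrac{\{}{\}}{0pt}{}{n+1}{2}_{s,t}^2x^n=\frac{x+(\{4\}_{s,t}\varphi_{s,t}-\varphi_{s,t}^4)x^2-\{3\}_{s,t}\varphi_{s,t}^3\varphi_{s,t}^{\prime3}x^3+(\{3\}_{s,t}\varphi_{s,t}^7\varphi_{s,t}^{\prime3}-\{4\}_{s,t}\varphi_{s,t}^6\varphi_{s,t}^{\prime3})x^4}{(1-t^2x)(1-\varphi_{s,t}^{\prime4}x)(\varphi_{s,t}^4x;q)_{4}}. \]
   Context: The generalized Fibonacci polynomials $\{n\}_{s,t}$ are defined by $\{0\}_{s,t}=0$, $\{1\}_{s,t}=1$, $\{n+2\}_{s,t}=s\{n+1\}_{s,t}+t\{n\}_{s,t}$. Set $\varphi_{s,t}=\frac{s+\sqrt{s^2+4t}}{2}$, $\varphi'_{s,t}=\frac{s-\sqrt{s^2+4t}}{2}$. The generalized triangular numbers are $\genfrac{\{}{\}}{0pt}{}{n+1}{2}_{s,t}=\frac{\{n\}_{s,t}\{n+1\}_{s,t}}{\{2\}_{s,t}}$. The $q$-Pochhammer symbol is $(a;q)_m=\prod_{k=0}^{m-1}(1-aq^k)$, so $(\varphi_{s,t}^4x;q)_4=\prod_{k=0}^{3}(1-\varphi_{s,t}^{4-k}\varphi_{s,t}^{\prime k}x)$. The identity is between formal power series in $x$. *)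

theory Defs
  imports Complex_Main "HOL-Computational_Algebra.Formal_Power_Series"
begin

fun gen_fib :: "real \<Rightarrow> real \<Rightarrow> nat \<Rightarrow> real" where
  "gen_fib s t 0 = 0"
| "gen_fib s t (Suc 0) = 1"
| "gen_fib s t (Suc (Suc n)) = s * gen_fib s t (Suc n) + t * gen_fib s t n"

text \<open>The discriminant \<open>s\<^sup>2 + 4 t\<close> may be negative for real \<open>s\<close>, \<open>t\<close>, so the two
  roots are complex numbers; the square root is the principal one, which agrees with the
  real square root when the discriminant is nonnegative.\<close>

definition phi :: "real \<Rightarrow> real \<Rightarrow> complex" where
  "phi s t = (of_real s + csqrt (of_real (s\<^sup>2 + 4 * t))) / 2"

definition phi' :: "real \<Rightarrow> real \<Rightarrow> complex" where
  "phi' s t = (of_real s - csqrt (of_real (s\<^sup>2 + 4 * t))) / 2"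

text \<open>\<open>gen_triangular s t n\<close> is the generalized binomial coefficient \<open>n + 1\<close> over \<open>2\<close>.\<close>

definition gen_triangular :: "real \<Rightarrow> real \<Rightarrow> nat \<Rightarrow> real" where
  "gen_triangular s t n = gen_fib s t n * gen_fib s t (n + 1) / gen_fib s t 2"

text \<open>Stated over an arbitrary commutative ring so that both arguments can be formal
  power series.\<close>

definition q_pochhammer :: "'a::comm_ring_1 \<Rightarrow> 'a \<Rightarrow> nat \<Rightarrow> 'a" where
  "q_pochhammer a q m = (\<Prod>k<m. 1 - a * q ^ k)"

end

theory Submission
  imports Defs
begin

text \<open>Write \<open>a\<close>, \<open>b\<close> for the two roots, so that \<open>s = a + b\<close> and \<open>t = - a b\<close>. The squared
  product of two consecutive terms of a sequence with characteristic roots \<open>a\<close>, \<open>b\<close> satisfies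
  the recurrence whose characteristic roots are \<open>a\<^sup>4, a\<^sup>3 b, a\<^sup>2 b\<^sup>2, a b\<^sup>3, b\<^sup>4\<close>. Checking this
  as a polynomial identity in two consecutive terms (rather than by Binet's formula) covers the
  case \<open>a = b\<close>. It yields the reduced fraction
  \<open>(x - t s\<^sup>2 x\<^sup>2 + t\<^sup>4 x\<^sup>3) / ((1 - t\<^sup>2 x) (1 - a\<^sup>4 x) (1 - a\<^sup>3 b x) (1 - a b\<^sup>3 x) (1 - b\<^sup>4 x))\<close>;
  the factor \<open>1 - a\<^sup>2 b\<^sup>2 x\<close> of the Pochhammer symbol duplicates \<open>1 - t\<^sup>2 x\<close>, and the
  theorem's fraction is the reduced one expanded by it.\<close>

lemma phi_add_phi': "phi s t + phi' s t = of_real s"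
  by (simp add: phi_def phi'_def field_simps)

lemma phi_mult_phi': "phi s t * phi' s t = - of_real t"
proof -
  have "phi s t * phi' s t = ((of_real s)\<^sup>2 - (csqrt (of_real (s\<^sup>2 + 4 * t)))\<^sup>2) / 4"
    by (simp add: phi_def phi'_def field_simps power2_eq_square)
  then show ?thesis
    by simp
qed

text \<open>In the next two lemmas, \<open>m = a\<^sup>2 + b\<^sup>2\<close>, \<open>P = a\<^sup>4 + b\<^sup>4\<close>, and \<open>1 + u x + w x\<^sup>2 + t\<^sup>4 u x\<^sup>3 + t\<^sup>8 x\<^sup>4\<close>
  is the product of the four factors other than \<open>1 - t\<^sup>2 x\<close>.\<close>

lemma gen_triangular_square_recurrence:
  fixes s t :: real
  defines "m \<equiv> s\<^sup>2 + 2 * t"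
  defines "P \<equiv> m\<^sup>2 - 2 * t\<^sup>2"
  defines "u \<equiv> t * m - P" and "w \<equiv> 2 * t ^ 4 - P * t * m"
  shows "(gen_triangular s t (n + 5))\<^sup>2 + (u - t\<^sup>2) * (gen_triangular s t (n + 4))\<^sup>2
     + (w - t\<^sup>2 * u) * (gen_triangular s t (n + 3))\<^sup>2
     + (t ^ 4 * u - t\<^sup>2 * w) * (gen_triangular s t (n + 2))\<^sup>2
     + (t ^ 8 - t ^ 6 * u) * (gen_triangular s t (n + 1))\<^sup>2
     - t ^ 10 * (gen_triangular s t n)\<^sup>2 = 0"
proof -
  define x where "x = gen_fib s t n"
  define y where "y = gen_fib s t (Suc n)"
  define f2 where "f2 = s * y + t * x"
  define f3 where "f3 = s * f2 + t * y"
  define f4 where "f4 = s * f3 + t * f2"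
  define f5 where "f5 = s * f4 + t * f3"
  define f6 where "f6 = s * f5 + t * f4"
  have "(f5 * f6)\<^sup>2 + (u - t\<^sup>2) * (f4 * f5)\<^sup>2 + (w - t\<^sup>2 * u) * (f3 * f4)\<^sup>2
     + (t ^ 4 * u - t\<^sup>2 * w) * (f2 * f3)\<^sup>2 + (t ^ 8 - t ^ 6 * u) * (y * f2)\<^sup>2
     - t ^ 10 * (x * y)\<^sup>2 = 0"
    unfolding f6_def f5_def f4_def f3_def f2_def u_def w_def P_def m_def by algebra
  \<comment> \<open>All six terms have the denominator \<open>gen_fib s t 2 = s\<close>, so the
    identity is just divided through by \<open>s\<^sup>2\<close>.\<close>
  moreover have "gen_triangular s t n = x * y / s"
    "gen_triangular s t (n + 1) = y * f2 / s"
    "gen_triangular s t (n + 2) = f2 * f3 / s"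
    "gen_triangular s t (n + 3) = f3 * f4 / s"
    "gen_triangular s t (n + 4) = f4 * f5 / s"
    "gen_triangular s t (n + 5) = f5 * f6 / s"
    by (simp_all add: gen_triangular_def x_def y_def f2_def f3_def f4_def f5_def f6_def
        numeral_eq_Suc)
  ultimately show ?thesis
    by (simp add: power_divide flip: add_divide_distrib diff_divide_distrib)
qed

lemma gen_triangular_square_fps_real:
  fixes s t :: real
  assumes "s \<noteq> 0"
  defines "m \<equiv> s\<^sup>2 + 2 * t"
  defines "P \<equiv> m\<^sup>2 - 2 * t\<^sup>2"
  defines "u \<equiv> t * m - P" and "w \<equiv> 2 * t ^ 4 - P * t * m"
  defines "C \<equiv> \<lambda>r. fps_const (complex_of_real r)"
  shows "(1 + C (u - t\<^sup>2) * fps_X + C (w - t\<^sup>2 * u) * fps_X ^ 2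
      + C (t ^ 4 * u - t\<^sup>2 * w) * fps_X ^ 3 + C (t ^ 8 - t ^ 6 * u) * fps_X ^ 4
      - C (t ^ 10) * fps_X ^ 5)
      * Abs_fps (\<lambda>n. complex_of_real ((gen_triangular s t n)\<^sup>2))
    = fps_X - C (t * s\<^sup>2) * fps_X ^ 2 + C (t ^ 4) * fps_X ^ 3" (is "?D * ?G = ?N")
proof (rule fps_ext)
  fix n
  define g where "g = (\<lambda>n. (gen_triangular s t n)\<^sup>2)"
  have D: "fps_nth (?D * ?G) n = complex_of_real (g n
      + (if n < 1 then 0 else (u - t\<^sup>2) * g (n - 1))
      + (if n < 2 then 0 else (w - t\<^sup>2 * u) * g (n - 2))
      + (if n < 3 then 0 else (t ^ 4 * u - t\<^sup>2 * w) * g (n - 3))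
      + (if n < 4 then 0 else (t ^ 8 - t ^ 6 * u) * g (n - 4))
      - (if n < 5 then 0 else t ^ 10 * g (n - 5)))"
    by (simp add: C_def g_def distrib_right left_diff_distrib mult.assoc fps_X_power_mult_nth)
  have N: "fps_nth ?N n = complex_of_real ((if n = 1 then 1 else 0)
      - (if n = 2 then t * s\<^sup>2 else 0) + (if n = 3 then t ^ 4 else 0))"
    by (simp add: C_def fps_X_power_nth)
  \<comment> \<open>Of two consecutive indices one is even, and its term has a factor
    \<open>s\<close>, which cancels the denominator as \<open>s\<close> is nonzero.\<close>
  have g: "g 0 = 0" "g 1 = 1" "g 2 = (s\<^sup>2 + t)\<^sup>2" "g 3 = ((s\<^sup>2 + t) * (s\<^sup>2 + 2 * t))\<^sup>2"
    "g 4 = ((s\<^sup>2 + 2 * t) * (s ^ 4 + 3 * s\<^sup>2 * t + t\<^sup>2))\<^sup>2"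
    using assms(1)
    by (simp_all add: g_def gen_triangular_def numeral_eq_Suc field_simps)
  note d = u_def w_def P_def m_def
  \<comment> \<open>The recurrence has order 5 and governs the coefficients from index 5 on; the
    five below it come from the initial values and give the numerator.\<close>
  have "n = 0 \<or> n = 1 \<or> n = 2 \<or> n = 3 \<or> n = 4 \<or> n \<ge> 5"
    by arith
  then consider "n = 0" | "n = 1" | "n = 2" | "n = 3" | "n = 4" | "n \<ge> 5"
    by blast
  then show "fps_nth (?D * ?G) n = fps_nth ?N n"
  proof cases
    case 1 then show ?thesis unfolding D N by (simp add: g)
  next
    case 2 then show ?thesis unfolding D N by (simp add: g flip: One_nat_def)
  next
    case 3
    have "g 2 + (u - t\<^sup>2) * g 1 = - (t * s\<^sup>2)"
      unfolding g d by algebra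
    with 3 show ?thesis
      unfolding D N by (intro arg_cong[of _ _ complex_of_real]) (simp add: g(1))
  next
    case 4
    have "g 3 + (u - t\<^sup>2) * g 2 + (w - t\<^sup>2 * u) * g 1 = t ^ 4"
      unfolding g d by algebra
    with 4 show ?thesis
      unfolding D N by (intro arg_cong[of _ _ complex_of_real]) (simp add: g(1))
  next
    case 5
    have "g 4 + (u - t\<^sup>2) * g 3 + (w - t\<^sup>2 * u) * g 2 + (t ^ 4 * u - t\<^sup>2 * w) * g 1 = 0"
      unfolding g d by algebra
    with 5 show ?thesis
      unfolding D N by (intro arg_cong[of _ _ complex_of_real]) (simp add: g(1))
  next
    case 6
    then obtain k where "n = k + 5"
      by (metis add.commute le_Suc_ex)
    have "g (k + 5) + (u - t\<^sup>2) * g (k + 4) + (w - t\<^sup>2 * u) * g (k + 3)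
        + (t ^ 4 * u - t\<^sup>2 * w) * g (k + 2) + (t ^ 8 - t ^ 6 * u) * g (k + 1)
        - t ^ 10 * g k = 0"
      unfolding g_def d by (rule gen_triangular_square_recurrence)
    with \<open>n = k + 5\<close> show ?thesis
      unfolding D N by (intro arg_cong[of _ _ complex_of_real]) (simp add: add.commute)
  qed
qed

text \<open>Since \<open>k < 4\<close>, the power \<open>a ^ 4\<close> absorbs the denominator of
  \<open>(b / a) ^ k\<close>, so every factor becomes polynomial in \<open>a\<close> and
  \<open>b\<close>.\<close>

lemma q_pochhammer_fps_ratio:
  fixes a b :: "'a::field"
  assumes "a \<noteq> 0"
  shows "q_pochhammer (fps_const (a ^ 4) * fps_X) (fps_const (b / a)) 4
    = (1 - fps_const (a ^ 4) * fps_X) * (1 - fps_const (a ^ 3 * b) * fps_X)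
      * (1 - fps_const (a\<^sup>2 * b\<^sup>2) * fps_X) * (1 - fps_const (a * b ^ 3) * fps_X)"
proof -
  have "fps_const (a ^ 4) * fps_X * fps_const (b / a) ^ k = fps_const (a ^ (4 - k) * b ^ k) * fps_X"
    if "k < 4" for k
  proof -
    have "a ^ 4 * (b / a) ^ k = a ^ (4 - k) * b ^ k"
      using assms that by (simp add: power_diff power_divide)
    then show ?thesis
      by (metis (no_types, lifting) fps_const_mult fps_const_power mult.assoc mult.commute)
  qed
  then have "q_pochhammer (fps_const (a ^ 4) * fps_X) (fps_const (b / a)) 4
    = (\<Prod>k<4. 1 - fps_const (a ^ (4 - k) * b ^ k) * fps_X)"
    unfolding q_pochhammer_def by (intro prod.cong) auto
  then show ?thesis
    by (simp add: numeral_eq_Suc lessThan_Suc mult_ac)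
qed

theorem theorem8:
  fixes s t :: real and q :: complex
  assumes "s \<noteq> 0" and "t \<noteq> 0" and "q = phi' s t / phi s t"
  shows
    "Abs_fps (\<lambda>n. if n = 0 then 0 else complex_of_real ((gen_triangular s t n)\<^sup>2)) =
      (fps_X
       + fps_const (of_real (gen_fib s t 4) * phi s t - phi s t ^ 4) * fps_X ^ 2
       - fps_const (of_real (gen_fib s t 3) * phi s t ^ 3 * phi' s t ^ 3) * fps_X ^ 3
       + fps_const (of_real (gen_fib s t 3) * phi s t ^ 7 * phi' s t ^ 3
                    - of_real (gen_fib s t 4) * phi s t ^ 6 * phi' s t ^ 3) * fps_X ^ 4)
      / ((1 - fps_const (of_real (t\<^sup>2)) * fps_X)
         * (1 - fps_const (phi' s t ^ 4) * fps_X)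
         * q_pochhammer (fps_const (phi s t ^ 4) * fps_X) (fps_const q) 4)"
    (is "?G = ?N / ?D")
proof -
  define a b where "a = phi s t" and "b = phi' s t"
  \<comment> \<open>With the roots as constant series, all remaining identities are polynomial in
    \<open>A\<close>, \<open>B\<close> and \<open>fps_X\<close>, within reach of
    \<open>algebra\<close>.\<close>
  define A B where "A = fps_const a" and "B = fps_const b"
  have s: "complex_of_real s = a + b" and t: "complex_of_real t = - (a * b)"
    using phi_add_phi'[of s t] phi_mult_phi'[of s t] by (simp_all add: a_def b_def)
  have "a \<noteq> 0"
    using t assms(2) by auto
  note hom = fps_const_add[symmetric] fps_const_sub[symmetric] fps_const_mult[symmetric]
    fps_const_neg[symmetric] fps_const_power[symmetric] numeral_fps_const[symmetric]
  have f3: "complex_of_real (gen_fib s t 3) = a\<^sup>2 + a * b + b\<^sup>2"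
    by (simp add: numeral_eq_Suc s t algebra_simps)
  have f4: "complex_of_real (gen_fib s t 4) = a ^ 3 + a\<^sup>2 * b + a * b\<^sup>2 + b ^ 3"
    by (simp add: numeral_eq_Suc s t algebra_simps)
  define G where "G = Abs_fps (\<lambda>n. complex_of_real ((gen_triangular s t n)\<^sup>2))"
  \<comment> \<open>The special case at index 0 is harmless because
    \<open>gen_fib s t 0 = 0\<close>.\<close>
  have G: "?G = G"
    by (rule fps_ext) (simp add: G_def gen_triangular_def)
  have D: "?D = (1 - (A * B)\<^sup>2 * fps_X) * (1 - B ^ 4 * fps_X) * ((1 - A ^ 4 * fps_X)
      * (1 - A ^ 3 * B * fps_X) * (1 - A\<^sup>2 * B\<^sup>2 * fps_X) * (1 - A * B ^ 3 * fps_X))"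
    using q_pochhammer_fps_ratio[OF \<open>a \<noteq> 0\<close>, of b] assms(3)
    by (simp add: A_def B_def t hom flip: a_def b_def del: fps_const_mult fps_const_power)
  have N: "?N = fps_X + ((A ^ 3 + A\<^sup>2 * B + A * B\<^sup>2 + B ^ 3) * A - A ^ 4) * fps_X ^ 2
      - ((A\<^sup>2 + A * B + B\<^sup>2) * A ^ 3 * B ^ 3) * fps_X ^ 3
      + ((A\<^sup>2 + A * B + B\<^sup>2) * A ^ 7 * B ^ 3
         - (A ^ 3 + A\<^sup>2 * B + A * B\<^sup>2 + B ^ 3) * A ^ 6 * B ^ 3) * fps_X ^ 4"
    unfolding f3 f4 a_def[symmetric] b_def[symmetric] A_def B_def hom ..
  have "(1 - (A * B)\<^sup>2 * fps_X) * (1 - B ^ 4 * fps_X) * (1 - A ^ 4 * fps_X)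
      * (1 - A ^ 3 * B * fps_X) * (1 - A * B ^ 3 * fps_X) * G
    = fps_X + A * B * (A + B)\<^sup>2 * fps_X\<^sup>2 + (A * B) ^ 4 * fps_X ^ 3" (is "?D' * G = ?N'")
  proof -
    \<comment> \<open>Substituting \<open>s = a + b\<close> and \<open>t = - (a * b)\<close> turns
      the expanded denominator into symmetric polynomials in \<open>A\<close> and \<open>B\<close>,
      which \<open>algebra\<close> then matches with the factored form.\<close>
    note h = gen_triangular_square_fps_real[OF assms(1), of t, folded G_def,
        unfolded of_real_add of_real_diff of_real_mult of_real_power of_real_numeral s t hom,
        folded A_def B_def]
    show ?thesis
      by (rule box_equals[OF h]) algebra+
  qed
  moreover have "?D = (1 - (A * B)\<^sup>2 * fps_X) * ?D'"
    unfolding D by algebra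
  moreover have "?N = (1 - (A * B)\<^sup>2 * fps_X) * ?N'"
    unfolding N by algebra
  ultimately have eq: "?D * G = ?N"
    by (simp only: mult.assoc)
  have "?D \<noteq> 0"
  proof -
    \<comment> \<open>Every factor of the denominator has constant coefficient 1, and complex power
      series form an integral domain.\<close>
    have "1 - c * fps_X \<noteq> 0" for c :: "complex fps"
      by (rule fps_nonzeroI[of _ 0]) simp
    then show ?thesis
      unfolding D by simp
  qed
  then have "G = ?D * G / ?D"
    by (rule nonzero_mult_div_cancel_left[symmetric])
  then show ?thesis
    unfolding G eq .
qed

end
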